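(* Suppose $q$ is not a root of unity. Then the center of $U_{g,h}$ is equal to $\mathbb{K}[g^{\pm1},h^{\pm1},C]$ (the subalgebra generated by $g^{\pm1},h^{\pm1},C$), where $$C=FE+\frac{qK+q^{-1}K^{-1}g^2}{(q-q^{-1})^2}.$$
   Context: $\mathbb{K}$ is an algebraically closed field of characteristic zero, and $q\in\mathbb{K}$ is nonzero with $q^2\neq 1$. $U_{g,h}$ is the unital associative $\mathbb{K}$-algebra generated by $E,F,K^{\pm1},g^{\pm1},h^{\pm1}$ with relations: $KK^{-1}=K^{-1}K=gg^{-1}=g^{-1}g=hh^{-1}=h^{-1}h=1$; $g$ and $h$ commute with each other and with $E,F,K$; $KEK^{-1}=q^2E$; $KFK^{-1}=q^{-2}F$; $EF-FE=\frac{K-K^{-1}g^2}{q-q^{-1}}$. *)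

theory Defs
  imports
    "HOL-Library.Poly_Mapping"
    "HOL-Algebra.Algebra"
    "HOL-Algebra.Algebraic_Closure_Type"
begin

datatype 'a free_monoid = Word (letters: "'a list")

text \<open>
  The free monoid, written additively (although it is not commutative): with this instance
  the product on \<^typ>\<open>'a free_monoid \<Rightarrow>\<^sub>0 'k\<close> is convolution along
  concatenation of words, so this type is the free unital associative algebra over
  the coefficients on the letters \<^typ>\<open>'a\<close>.
\<close>

instantiation free_monoid :: (type) monoid_add
begin

definition zero_free_monoid :: "'a free_monoid"
  where "zero_free_monoid = Word []"

definition plus_free_monoid :: "'a free_monoid \<Rightarrow> 'a free_monoid \<Rightarrow> 'a free_monoid"
  where "plus_free_monoid v w = Word (letters v @ letters w)"

instance
  by standard (simp_all add: zero_free_monoid_def plus_free_monoid_def)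

end

type_synonym ('a, 'k) free_algebra = "'a free_monoid \<Rightarrow>\<^sub>0 'k"

definition free_gen :: "'a \<Rightarrow> ('a, 'k::comm_ring_1) free_algebra"
  where "free_gen x = Poly_Mapping.single (Word [x]) 1"

definition scalar :: "'k::comm_ring_1 \<Rightarrow> ('a, 'k) free_algebra"
  where "scalar c = Poly_Mapping.single 0 c"

text \<open>The suffix \<open>i\<close> marks the generators that become inverses in the quotient.\<close>

datatype generator = gen_E | gen_F | gen_K | gen_Ki | gen_g | gen_gi | gen_h | gen_hi

definition relators :: "'k::field \<Rightarrow> (generator, 'k) free_algebra set"
  where "relators q =
    (let E = free_gen gen_E; F = free_gen gen_F; K = free_gen gen_K; Ki = free_gen gen_Ki;
         g = free_gen gen_g; gi = free_gen gen_gi; h = free_gen gen_h; hi = free_gen gen_hi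
     in {K * Ki - 1, Ki * K - 1, g * gi - 1, gi * g - 1, h * hi - 1, hi * h - 1,
         g * h - h * g,
         g * E - E * g, g * F - F * g, g * K - K * g,
         h * E - E * h, h * F - F * h, h * K - K * h,
         K * E * Ki - scalar (q ^ 2) * E,
         K * F * Ki - scalar (inverse q ^ 2) * F,
         E * F - F * E - scalar (1 / (q - inverse q)) * (K - Ki * g ^ 2)})"

definition rel_ideal :: "'k::field \<Rightarrow> (generator, 'k) free_algebra set"
  where "rel_ideal q = genideal ring_of_type_algebra (relators q)"

definition U_gh :: "'k::field \<Rightarrow> (generator, 'k) free_algebra set ring"
  where "U_gh q = ring_of_type_algebra Quot rel_ideal q"

definition U_class :: "'k::field \<Rightarrow> (generator, 'k) free_algebra \<Rightarrow> (generator, 'k) free_algebra set"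
  where "U_class q x = rel_ideal q +>\<^bsub>ring_of_type_algebra\<^esub> x"

definition casimir :: "'k::field \<Rightarrow> (generator, 'k) free_algebra"
  where "casimir q =
    free_gen gen_F * free_gen gen_E
      + scalar (1 / (q - inverse q) ^ 2)
        * (scalar q * free_gen gen_K + scalar (inverse q) * free_gen gen_Ki * free_gen gen_g ^ 2)"

definition ring_center :: "('a, 'b) ring_scheme \<Rightarrow> 'a set"
  where "ring_center R = {z \<in> carrier R. \<forall>x \<in> carrier R. z \<otimes>\<^bsub>R\<^esub> x = x \<otimes>\<^bsub>R\<^esub> z}"

text \<open>
  The unital subalgebra generated by \<open>S\<close>, for the algebra structure on \<open>R\<close> given by the
  map \<open>\<eta>\<close> from the base field to \<open>R\<close>: the subring generated by \<open>S\<close> and the scalars.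
\<close>

definition generated_subalgebra :: "('k \<Rightarrow> 'a) \<Rightarrow> ('a, 'b) ring_scheme \<Rightarrow> 'a set \<Rightarrow> 'a set"
  where "generated_subalgebra \<eta> R S = generate_ring R (range \<eta> \<union> S)"

lemma ring_free_algebra:
  "ring (ring_of_type_algebra :: ('a, 'k::comm_ring_1) free_algebra ring)"
proof -
  have "\<exists>y. x + y = 0 \<and> y + x = 0" for x :: "('a, 'k) free_algebra"
    by (rule exI[of _ "- x"]) simp
  thus ?thesis
    unfolding ring_of_type_algebra_def
    by unfold_locales (auto simp: algebra_simps Units_def)
qed

lemma ideal_rel_ideal: "ideal (rel_ideal q) ring_of_type_algebra"
  unfolding rel_ideal_def
  by (rule ring.genideal_ideal[OF ring_free_algebra]) (simp add: ring_of_type_algebra_def)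

lemma ring_U_gh: "ring (U_gh q)"
  unfolding U_gh_def by (rule ideal.quotient_is_ring[OF ideal_rel_ideal])

end

theory Submission
  imports Defs
begin

text \<open>
  The proof compares expansions in the basis of monomials
  \<open>g\<^sup>m h\<^sup>n F\<^sup>a K\<^sup>l E\<^sup>b\<close>, filtered by the exponent \<open>a\<close> of \<open>F\<close>.

  A central \<open>z\<close> commutes with \<open>K\<close>. A factor \<open>K\<close> reaches its place in the monomial above from
  the left at the cost of \<open>q\<close> to the power \<open>-2a\<close> and from the right at the cost of \<open>q\<close> to the
  power \<open>-2b\<close>. As \<open>q\<close> is not a root of unity, only monomials with \<open>a = b\<close> occur in \<open>z\<close>
  (\<open>central_coef_diagonal\<close>). Let \<open>N\<close> be the largest \<open>a\<close> that occurs. The part of \<open>E z = z E\<close>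
  that is of degree \<open>N\<close> in \<open>F\<close> comes from the top part of \<open>z\<close> alone, since moving \<open>E\<close> past a
  power of \<open>F\<close> produces otherwise only fewer factors \<open>F\<close>. There \<open>E\<close> is moved past \<open>K\<^sup>l\<close>, which
  costs the factor \<open>q\<close> to the power \<open>-2l\<close>, while in \<open>z E\<close> it joins the other factors \<open>E\<close> at no
  cost; hence \<open>l = 0\<close> in the top part (\<open>central_top_coef\<close>). So the top part is \<open>F\<^sup>N E\<^sup>N\<close> times
  a Laurent polynomial \<open>p\<close> in \<open>g\<close> and \<open>h\<close>. As \<open>C\<^sup>N\<close> is \<open>F\<^sup>N E\<^sup>N\<close> up to smaller powers of \<open>F\<close>
  (\<open>coef_casimir_power\<close>), the element \<open>z - p C\<^sup>N\<close> is central and has smaller degree, and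
  induction on \<open>N\<close> finishes the argument (\<open>central_in_generated\<close>).

  That the monomials form a basis is obtained from a representation. The algebra acts on all
  functions from exponents to scalars by the formulas that left multiplication would have on
  coefficients (\<open>pbw_op\<close>); these satisfy the defining relations (\<open>rep_relator\<close>), so the action is
  defined modulo the relations. Applied to the expansion of \<open>1\<close>, a monomial gives the indicator
  function of its exponents (\<open>coef_pbw_monomial\<close>), which is linear independence; spanning is a
  rewriting argument (\<open>pbw_spanning\<close>). The quotient is handled throughout by congruence in the free
  algebra, where the type-class ring operations are at hand.
\<close>

section \<open>The free algebra and its representations\<close>

lemma single_Word_Cons:
  "Poly_Mapping.single (Word (s # u)) c = free_gen s * Poly_Mapping.single (Word u) c"
  by (simp add: free_gen_def mult_single plus_free_monoid_def)

lemma scalar_add: "scalar (c + d) = scalar c + scalar d"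
  and scalar_mult: "scalar (c * d) = scalar c * scalar d"
  and scalar_0 [simp]: "scalar 0 = 0"
  and scalar_1 [simp]: "scalar 1 = 1"
  and scalar_minus: "scalar (- c) = - scalar c"
  by (simp_all add: scalar_def single_add mult_single single_uminus)

lemma update_eq_add_single:
  assumes "w \<notin> Poly_Mapping.keys f"
  shows "Poly_Mapping.update w c f = f + Poly_Mapping.single w c"
  using assms by (intro poly_mapping_eqI)
    (auto simp: lookup_update lookup_add lookup_single when_def in_keys_iff)

lemma free_algebra_induct [case_names scalar add gen]:
  fixes x :: "('a, 'k::comm_ring_1) free_algebra"
  assumes "\<And>c. P (scalar c)"
    and "\<And>x y. P x \<Longrightarrow> P y \<Longrightarrow> P (x + y)"
    and "\<And>s x. P x \<Longrightarrow> P (free_gen s * x)"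
  shows "P x"
proof -
  have word: "P (Poly_Mapping.single w c)" for w c
  proof (cases w)
    case (Word u)
    have "P (Poly_Mapping.single (Word u) c)"
    proof (induction u)
      case Nil
      then show ?case
        using assms(1)[of c] by (simp add: scalar_def zero_free_monoid_def)
    next
      case (Cons s u)
      then show ?case by (simp add: single_Word_Cons assms(3))
    qed
    then show ?thesis using Word by simp
  qed
  show ?thesis
  proof (induction x rule: update_induct)
    case const
    then show ?case using assms(1)[of 0] by simp
  next
    case (update f w c)
    then show ?case by (simp add: update_eq_add_single assms(2) word)
  qed
qed

lemma scalar_commute:
  fixes x :: "('a, 'k::comm_ring_1) free_algebra"
  shows "scalar c * x = x * scalar c"
proof (induction x rule: free_algebra_induct)
  case (scalar d)
  then show ?case by (simp flip: scalar_mult add: mult.commute)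
next
  case (add x y)
  then show ?case by (simp add: algebra_simps)
next
  case (gen s x)
  have "scalar c * free_gen s = free_gen s * (scalar c :: ('a, 'k) free_algebra)"
    by (simp add: scalar_def free_gen_def mult_single)
  then show ?case by (metis gen mult.assoc)
qed

definition linear_op :: "(('i \<Rightarrow> 'k::comm_ring_1) \<Rightarrow> ('i \<Rightarrow> 'k)) \<Rightarrow> bool"
  where "linear_op f \<longleftrightarrow>
    (\<forall>c v d w. f (\<lambda>i. c * v i + d * w i) = (\<lambda>i. c * f v i + d * f w i))"

lemma linear_opD:
  assumes "linear_op f"
  shows "f (\<lambda>i. v i + w i) = (\<lambda>i. f v i + f w i)"
    and "f (\<lambda>i. c * v i) = (\<lambda>i. c * f v i)"
    and "f (\<lambda>i. 0) = (\<lambda>i. 0)"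
  using assms[unfolded linear_op_def, rule_format, of 1 v 1 w]
    assms[unfolded linear_op_def, rule_format, of c v 0 v]
    assms[unfolded linear_op_def, rule_format, of 0 v 0 v] by simp_all

lemma linear_op_diff:
  assumes "linear_op f"
  shows "f (\<lambda>i. v i - w i) = (\<lambda>i. f v i - f w i)"
  using assms[unfolded linear_op_def, rule_format, of 1 v "- 1" w] by simp

text \<open>
  The action of the free algebra that extends an assignment of operators to letters. It acts on all
  functions \<open>'i \<Rightarrow> 'k\<close>, not only on the finitely supported ones, so that operators can be written
  down pointwise without a support condition.
\<close>

definition rep ::
  "('a \<Rightarrow> ('i \<Rightarrow> 'k) \<Rightarrow> ('i \<Rightarrow> 'k)) \<Rightarrow> ('a, 'k::comm_ring_1) free_algebra \<Rightarrow> ('i \<Rightarrow> 'k) \<Rightarrow> ('i \<Rightarrow> 'k)"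
  where "rep L x v =
    (\<lambda>i. \<Sum>w\<in>Poly_Mapping.keys x. Poly_Mapping.lookup x w * foldr L (letters w) v i)"

lemma rep_superset:
  assumes "finite W" and "Poly_Mapping.keys x \<subseteq> W"
  shows "rep L x v i = (\<Sum>w\<in>W. Poly_Mapping.lookup x w * foldr L (letters w) v i)"
  unfolding rep_def using assms by (intro sum.mono_neutral_left) (auto simp: in_keys_iff)

lemma rep_add: "rep L (x + y) v = (\<lambda>i. rep L x v i + rep L y v i)"
proof
  fix i
  let ?W = "Poly_Mapping.keys x \<union> Poly_Mapping.keys y"
  have "Poly_Mapping.keys (x + y) \<subseteq> ?W" by (rule keys_add)
  then show "rep L (x + y) v i = rep L x v i + rep L y v i"
    by (simp add: rep_superset[of ?W] lookup_add sum.distrib distrib_right)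
qed

lemma rep_scalar: "rep L (scalar c) v = (\<lambda>i. c * v i)"
proof
  fix i
  show "rep L (scalar c) v i = c * v i"
    by (subst rep_superset[of "{0}"])
      (auto simp: scalar_def zero_free_monoid_def split: if_splits)
qed

context
  fixes L :: "'a \<Rightarrow> ('i \<Rightarrow> 'k::comm_ring_1) \<Rightarrow> ('i \<Rightarrow> 'k)"
  assumes lin: "\<And>s. linear_op (L s)"
begin

lemma rep_single: "rep L (Poly_Mapping.single w c) v = (\<lambda>i. c * foldr L (letters w) v i)"
  by (rule ext, subst rep_superset[of "{w}"]) (auto split: if_splits)

lemma rep_gen_mult: "rep L (free_gen s * x) v = L s (rep L x v)"
proof (induction x rule: update_induct)
  case const
  then show ?case by (simp add: rep_def linear_opD(3)[OF lin])
next
  case (update f w c)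
  have eq: "Poly_Mapping.update w c f = f + Poly_Mapping.single w c"
    using update(1) by (rule update_eq_add_single)
  have "rep L (free_gen s * Poly_Mapping.single w c) v = L s (rep L (Poly_Mapping.single w c) v)"
    by (simp add: free_gen_def mult_single rep_single plus_free_monoid_def
        linear_opD(2)[OF lin])
  then show ?case
    by (simp add: eq distrib_left rep_add update linear_opD(1)[OF lin])
qed

lemma rep_mult: "rep L (x * y) v = rep L x (rep L y v)"
proof (induction x rule: free_algebra_induct)
  case (scalar c)
  then show ?case
  proof (induction y rule: free_algebra_induct)
    case (scalar d)
    then show ?case by (simp flip: scalar_mult add: rep_scalar mult.assoc)
  next
    case (add x y)
    then show ?case by (simp add: distrib_left rep_add rep_scalar)
  next
    case (gen s x)
    have "scalar c * (free_gen s * x) = free_gen s * (scalar c * x)"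
      by (metis mult.assoc scalar_commute)
    then show ?case using gen by (simp add: rep_gen_mult rep_scalar linear_opD(2)[OF lin])
  qed
next
  case (add x y)
  then show ?case by (simp add: distrib_right rep_add)
next
  case (gen s x)
  then show ?case by (simp add: mult.assoc rep_gen_mult)
qed

lemma rep_1: "rep L 1 v = v"
  using rep_scalar[of L 1 v] by simp

lemma rep_gen: "rep L (free_gen s) v = L s v"
  using rep_gen_mult[of s 1 v] by (simp add: rep_1)

lemma rep_diff: "rep L (x - y) v = (\<lambda>i. rep L x v i - rep L y v i)"
proof -
  have "rep L x v = rep L (x - y + y) v" by simp
  also have "\<dots> = (\<lambda>i. rep L (x - y) v i + rep L y v i)" by (rule rep_add)
  finally show ?thesis by simp
qed

lemma rep_power: "rep L (x ^ n) v = (rep L x ^^ n) v"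
  by (induction n) (simp_all add: rep_1 rep_mult)

lemma linear_rep: "linear_op (rep L x)"
  unfolding linear_op_def
proof (intro allI)
  fix c v d w
  show "rep L x (\<lambda>i. c * v i + d * w i) = (\<lambda>i. c * rep L x v i + d * rep L x w i)"
    using lin[unfolded linear_op_def]
    by (induction x rule: free_algebra_induct)
      (simp_all add: rep_scalar rep_add rep_gen_mult algebra_simps)
qed

text \<open>
  An operator that commutes with the letters commutes with the whole action. It serves for right
  multiplications, which commute with the left multiplications that \<open>rep\<close> describes.
\<close>

lemma rep_commute:
  assumes "linear_op R" and "\<And>s v. R (L s v) = L s (R v)"
  shows "R (rep L x v) = rep L x (R v)"
  using assms by (induction x rule: free_algebra_induct)
    (simp_all add: rep_scalar rep_add rep_gen_mult linear_opD)

end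

section \<open>The Poincare-Birkhoff-Witt representation\<close>

text \<open>
  The index \<open>(a, l, b, m, n)\<close> stands for the monomial
  \<open>g\<^sup>m h\<^sup>n F\<^sup>a K\<^sup>l E\<^sup>b\<close>.
\<close>

type_synonym pbw_index = "nat \<times> int \<times> nat \<times> int \<times> int"

text \<open>
  Left multiplication by a letter, on coefficients. Each right-hand side collects the monomials whose
  product with the letter contributes to the index on the left; for \<open>F\<close>, \<open>K\<close>, \<open>g\<close>, \<open>h\<close> and
  the inverses there is at most one of them. The letter \<open>E\<close> either moves through
  \<open>F\<^sup>a K\<^sup>l\<close> to join \<open>E\<^sup>b\<close>, or it meets one of the factors of
  \<open>F\<^bsup>a+1\<^esup>\<close> and is replaced by the commutator \<open>(K - K\<^sup>-\<^sup>1 g\<^sup>2) / (q - q\<^sup>-\<^sup>1)\<close>, which then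
  moves past the \<open>j\<close> factors \<open>F\<close> behind it. Summation over \<open>j\<close> gives the two geometric sums.
\<close>

fun pbw_op :: "'k::field \<Rightarrow> generator \<Rightarrow> (pbw_index \<Rightarrow> 'k) \<Rightarrow> pbw_index \<Rightarrow> 'k"
  where
    "pbw_op q gen_F v (a, l, b, m, n) = (case a of 0 \<Rightarrow> 0 | Suc a' \<Rightarrow> v (a', l, b, m, n))"
  | "pbw_op q gen_K v (a, l, b, m, n) = (inverse q ^ 2) ^ a * v (a, l - 1, b, m, n)"
  | "pbw_op q gen_Ki v (a, l, b, m, n) = (q ^ 2) ^ a * v (a, l + 1, b, m, n)"
  | "pbw_op q gen_g v (a, l, b, m, n) = v (a, l, b, m - 1, n)"
  | "pbw_op q gen_gi v (a, l, b, m, n) = v (a, l, b, m + 1, n)"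
  | "pbw_op q gen_h v (a, l, b, m, n) = v (a, l, b, m, n - 1)"
  | "pbw_op q gen_hi v (a, l, b, m, n) = v (a, l, b, m, n + 1)"
  | "pbw_op q gen_E v (a, l, b, m, n) =
      (case b of 0 \<Rightarrow> 0 | Suc b' \<Rightarrow> (q ^ 2) powi (- l) * v (a, l, b', m, n))
      + 1 / (q - inverse q) *
        ((\<Sum>j\<le>a. (inverse q ^ 2) ^ j) * v (Suc a, l - 1, b, m, n)
          - (\<Sum>j\<le>a. (q ^ 2) ^ j) * v (Suc a, l + 1, b, m - 2, n))"

lemma linear_pbw_op: "linear_op (pbw_op q s)"
  unfolding linear_op_def
proof (intro allI ext)
  fix c v d w and i :: pbw_index
  show "pbw_op q s (\<lambda>i. c * v i + d * w i) i = c * pbw_op q s v i + d * pbw_op q s w i"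
    by (cases i, cases s) (simp_all add: algebra_simps add_divide_distrib diff_divide_distrib split: nat.splits)
qed

lemmas rep_simps = rep_add rep_scalar rep_diff[OF linear_pbw_op] rep_mult[OF linear_pbw_op]
  rep_1[OF linear_pbw_op] rep_gen[OF linear_pbw_op] power2_eq_square[of "free_gen _"]

locale nonroot_of_unity =
  fixes q :: "'k::field"
  assumes q_nonzero: "q \<noteq> 0" and not_root: "\<And>n. n > 0 \<Longrightarrow> q ^ n \<noteq> 1"
begin

lemma powi_one_minus: "(q ^ 2) powi (1 - i) = q ^ 2 * (q ^ 2) powi (- i)"
  using q_nonzero by (simp add: power_int_diff power_int_minus field_simps)

lemma cancel_power: "(q ^ 2) ^ i * (inverse ((q ^ 2) ^ i) * z) = z"
  using q_nonzero by simp

text \<open>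
  The case of \<open>E F - F E\<close> carries the content: the two geometric sums for \<open>a\<close> and \<open>a - 1\<close> differ by their
  last terms, which are the scalars by which \<open>K\<close> and its inverse act in degree \<open>a\<close>.
\<close>

lemma rep_relator:
  assumes "r \<in> relators q"
  shows "rep (pbw_op q) r v = (\<lambda>i. 0)"
proof
  fix i :: pbw_index
  obtain a l b m n where i: "i = (a, l, b, m, n)" by (cases i)
  show "rep (pbw_op q) r v i = 0"
    using assms q_nonzero unfolding relators_def Let_def i
    by (elim insertE emptyE; hypsubst)
      (simp_all add: rep_simps powi_one_minus cancel_power power_inverse algebra_simps
        add_divide_distrib diff_divide_distrib split: nat.splits)
qed


section \<open>Congruence modulo the defining relations\<close>

lemma rel_ideal_closed:
  shows rel_ideal_0: "0 \<in> rel_ideal q"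
    and rel_ideal_add: "\<And>x y. x \<in> rel_ideal q \<Longrightarrow> y \<in> rel_ideal q \<Longrightarrow> x + y \<in> rel_ideal q"
    and rel_ideal_left: "\<And>x y. y \<in> rel_ideal q \<Longrightarrow> x * y \<in> rel_ideal q"
    and rel_ideal_right: "\<And>x y. x \<in> rel_ideal q \<Longrightarrow> x * y \<in> rel_ideal q"
    and rel_ideal_relator: "relators q \<subseteq> rel_ideal q"
proof -
  interpret ideal "rel_ideal q" ring_of_type_algebra by (rule ideal_rel_ideal)
  show "0 \<in> rel_ideal q"
    using additive_subgroup.zero_closed[OF is_additive_subgroup] by (simp add: ring_of_type_algebra_def)
  show "\<And>x y. x \<in> rel_ideal q \<Longrightarrow> y \<in> rel_ideal q \<Longrightarrow> x + y \<in> rel_ideal q"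
    using additive_subgroup.a_closed[OF is_additive_subgroup] by (simp add: ring_of_type_algebra_def)
  show "\<And>x y. y \<in> rel_ideal q \<Longrightarrow> x * y \<in> rel_ideal q"
    using I_l_closed by (simp add: ring_of_type_algebra_def)
  show "\<And>x y. x \<in> rel_ideal q \<Longrightarrow> x * y \<in> rel_ideal q"
    using I_r_closed by (simp add: ring_of_type_algebra_def)
  show "relators q \<subseteq> rel_ideal q"
    unfolding rel_ideal_def
    by (rule ring.genideal_self[OF ring_free_algebra]) (simp add: ring_of_type_algebra_def)
qed

lemma rel_ideal_uminus: "x \<in> rel_ideal q \<Longrightarrow> - x \<in> rel_ideal q"
  using rel_ideal_left[of x "- 1"] by simp

text \<open>
  The elements that act as zero form a two-sided ideal, which contains the relators.
\<close>

lemma rep_rel_ideal: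
  assumes "x \<in> rel_ideal q"
  shows "rep (pbw_op q) x v = (\<lambda>i. 0)"
proof -
  let ?N = "{x. \<forall>v. rep (pbw_op q) x v = (\<lambda>i. 0)}"
  have "ideal ?N ring_of_type_algebra"
  proof (rule idealI[OF ring_free_algebra])
    interpret ring "ring_of_type_algebra :: (generator, 'k) free_algebra ring"
      by (rule ring_free_algebra)
    show "subgroup ?N (add_monoid ring_of_type_algebra)"
    proof (rule add.subgroupI)
      fix x assume "x \<in> ?N"
      moreover have "\<ominus>\<^bsub>ring_of_type_algebra\<^esub> x = - x"
        by (rule minus_equality) (simp_all add: ring_of_type_algebra_def)
      moreover have "rep (pbw_op q) (- x) v = (\<lambda>i. - rep (pbw_op q) x v i)" for v
        using rep_diff[OF linear_pbw_op, where x = 0 and y = x] rep_scalar[of "pbw_op q" 0 v] by simp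
      ultimately show "\<ominus>\<^bsub>ring_of_type_algebra\<^esub> x \<in> ?N" by simp
    next
      have "0 \<in> ?N" using rep_scalar[of "pbw_op q" 0] by simp
      then show "?N \<noteq> {}" by blast
    qed (simp_all add: ring_of_type_algebra_def rep_simps)
  qed (simp_all add: ring_of_type_algebra_def rep_simps linear_opD(3)[OF linear_rep[OF linear_pbw_op]])
  moreover have "relators q \<subseteq> ?N" using rep_relator by blast
  ultimately have "rel_ideal q \<subseteq> ?N"
    unfolding rel_ideal_def by (rule ring.genideal_minimal[OF ring_free_algebra])
  then show ?thesis using assms by blast
qed

definition congU :: "(generator, 'k) free_algebra \<Rightarrow> (generator, 'k) free_algebra \<Rightarrow> bool"
    (infix "\<simeq>\<^sub>U" 50)
  where "x \<simeq>\<^sub>U y \<longleftrightarrow> x - y \<in> rel_ideal q"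

lemma cong_refl [simp, intro!]: "x \<simeq>\<^sub>U x"
  by (simp add: congU_def rel_ideal_0)

lemma cong_sym: "x \<simeq>\<^sub>U y \<Longrightarrow> y \<simeq>\<^sub>U x"
  using rel_ideal_uminus by (fastforce simp: congU_def)

lemma cong_trans [trans]: "x \<simeq>\<^sub>U y \<Longrightarrow> y \<simeq>\<^sub>U z \<Longrightarrow> x \<simeq>\<^sub>U z"
  using rel_ideal_add[of "x - y" "y - z"] by (simp add: congU_def)

lemma cong_add: "x \<simeq>\<^sub>U x' \<Longrightarrow> y \<simeq>\<^sub>U y' \<Longrightarrow> x + y \<simeq>\<^sub>U x' + y'"
  using rel_ideal_add[of "x - x'" "y - y'"] by (simp add: congU_def algebra_simps)

lemma cong_mult:
  assumes "x \<simeq>\<^sub>U x'" and "y \<simeq>\<^sub>U y'"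
  shows "x * y \<simeq>\<^sub>U x' * y'"
proof -
  have "x * y - x' * y' = (x - x') * y + x' * (y - y')" by (simp add: algebra_simps)
  then show ?thesis
    using assms rel_ideal_add rel_ideal_left rel_ideal_right by (simp add: congU_def)
qed

lemma cong_rep: "x \<simeq>\<^sub>U y \<Longrightarrow> rep (pbw_op q) x v = rep (pbw_op q) y v"
  using rep_rel_ideal[of "x - y" v] by (simp add: congU_def rep_simps fun_eq_iff)

lemma U_class_eq_iff: "U_class q x = U_class q y \<longleftrightarrow> x \<simeq>\<^sub>U y"
proof -
  interpret ideal "rel_ideal q" ring_of_type_algebra by (rule ideal_rel_ideal)
  have coset: "x \<in> U_class q y \<longleftrightarrow> x \<simeq>\<^sub>U y" for x y
    by (force simp: U_class_def a_r_coset_def' ring_of_type_algebra_def congU_def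
        intro: bexI[of _ "x - y"])
  show ?thesis
  proof
    assume "U_class q x = U_class q y"
    then show "x \<simeq>\<^sub>U y" using coset[of x x] coset[of x y] by simp
  next
    assume "x \<simeq>\<^sub>U y"
    then show "U_class q x = U_class q y"
      using coset cong_sym cong_trans by blast
  qed
qed

lemma U_class_hom: "U_class q \<in> ring_hom ring_of_type_algebra (U_gh q)"
  unfolding U_gh_def U_class_def[abs_def] by (rule ideal.rcos_ring_hom[OF ideal_rel_ideal])

lemma U_class_add: "U_class q (x + y) = U_class q x \<oplus>\<^bsub>U_gh q\<^esub> U_class q y"
  and U_class_mult: "U_class q (x * y) = U_class q x \<otimes>\<^bsub>U_gh q\<^esub> U_class q y"
  and U_class_one: "U_class q 1 = \<one>\<^bsub>U_gh q\<^esub>"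
  using ring_hom_add[OF U_class_hom] ring_hom_mult[OF U_class_hom] ring_hom_one[OF U_class_hom]
  by (simp_all add: ring_of_type_algebra_def)

lemma carrier_U_gh: "carrier (U_gh q) = range (U_class q)"
  by (auto simp: U_gh_def U_class_def FactRing_def A_RCOSETS_def' ring_of_type_algebra_def)

abbreviation E :: "(generator, 'k) free_algebra" where "E \<equiv> free_gen gen_E"
abbreviation F :: "(generator, 'k) free_algebra" where "F \<equiv> free_gen gen_F"
abbreviation K :: "(generator, 'k) free_algebra" where "K \<equiv> free_gen gen_K"
abbreviation Ki :: "(generator, 'k) free_algebra" where "Ki \<equiv> free_gen gen_Ki"
abbreviation G :: "(generator, 'k) free_algebra" where "G \<equiv> free_gen gen_g"
abbreviation Gi :: "(generator, 'k) free_algebra" where "Gi \<equiv> free_gen gen_gi"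
abbreviation H :: "(generator, 'k) free_algebra" where "H \<equiv> free_gen gen_h"
abbreviation Hi :: "(generator, 'k) free_algebra" where "Hi \<equiv> free_gen gen_hi"

section \<open>Commutation rules and central elements\<close>

lemma defining_relations:
  shows "K * Ki \<simeq>\<^sub>U 1" "Ki * K \<simeq>\<^sub>U 1" "G * Gi \<simeq>\<^sub>U 1" "Gi * G \<simeq>\<^sub>U 1" "H * Hi \<simeq>\<^sub>U 1" "Hi * H \<simeq>\<^sub>U 1"
    and "G * H \<simeq>\<^sub>U H * G"
    and "G * E \<simeq>\<^sub>U E * G" "G * F \<simeq>\<^sub>U F * G" "G * K \<simeq>\<^sub>U K * G"
    and "H * E \<simeq>\<^sub>U E * H" "H * F \<simeq>\<^sub>U F * H" "H * K \<simeq>\<^sub>U K * H"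
    and KEKi: "K * E * Ki \<simeq>\<^sub>U scalar (q ^ 2) * E"
    and KFKi: "K * F * Ki \<simeq>\<^sub>U scalar (inverse q ^ 2) * F"
    and EF: "E * F \<simeq>\<^sub>U F * E + scalar (1 / (q - inverse q)) * (K - Ki * G ^ 2)"
  using rel_ideal_relator unfolding congU_def relators_def Let_def
  by (simp_all add: algebra_simps)

lemma cong_left: "x \<simeq>\<^sub>U y \<Longrightarrow> z * x \<simeq>\<^sub>U z * y"
  and cong_right: "x \<simeq>\<^sub>U y \<Longrightarrow> x * z \<simeq>\<^sub>U y * z"
  by (simp_all add: cong_mult)

lemma scalar_left_commute: "x * (scalar c * y) = scalar c * (x * y)"
  for x :: "(generator, 'k) free_algebra"
  by (metis mult.assoc scalar_commute)

lemma commute_inverse: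
  assumes "x * z \<simeq>\<^sub>U z * x" and "x * y \<simeq>\<^sub>U 1" and "y * x \<simeq>\<^sub>U 1"
  shows "y * z \<simeq>\<^sub>U z * y"
proof -
  have "y * z \<simeq>\<^sub>U y * z * (x * y)" using cong_left[OF cong_sym[OF assms(2)], of "y * z"] by simp
  also have "\<dots> = y * (z * x) * y" by (simp add: mult.assoc)
  also have "\<dots> \<simeq>\<^sub>U y * (x * z) * y" by (intro cong_left cong_right cong_sym[OF assms(1)])
  also have "\<dots> = (y * x) * (z * y)" by (simp add: mult.assoc)
  also have "\<dots> \<simeq>\<^sub>U z * y" using cong_right[OF assms(3)] by simp
  finally show ?thesis .
qed

definition central :: "(generator, 'k) free_algebra \<Rightarrow> bool"
  where "central x \<longleftrightarrow> (\<forall>y. x * y \<simeq>\<^sub>U y * x)"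

lemma centralD: "central x \<Longrightarrow> x * y \<simeq>\<^sub>U y * x"
  by (simp add: central_def)

lemma commute_mult:
  assumes "x * y \<simeq>\<^sub>U y * x" and "x * z \<simeq>\<^sub>U z * x"
  shows "x * (y * z) \<simeq>\<^sub>U (y * z) * x"
proof -
  have "x * (y * z) = x * y * z" by (simp add: mult.assoc)
  also have "\<dots> \<simeq>\<^sub>U y * x * z" by (rule cong_right[OF assms(1)])
  also have "\<dots> = y * (x * z)" by (simp add: mult.assoc)
  also have "\<dots> \<simeq>\<^sub>U y * (z * x)" by (rule cong_left[OF assms(2)])
  finally show ?thesis by (simp add: mult.assoc)
qed

lemma centralI:
  assumes "\<And>s. x * free_gen s \<simeq>\<^sub>U free_gen s * x"
  shows "central x"
  unfolding central_def
proof
  fix y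
  show "x * y \<simeq>\<^sub>U y * x"
  proof (induction y rule: free_algebra_induct)
    case (scalar c)
    then show ?case by (simp add: scalar_commute)
  next
    case (add y z)
    then show ?case by (simp add: distrib_left distrib_right cong_add)
  next
    case (gen s y)
    then show ?case by (intro commute_mult assms)
  qed
qed

lemma central_inverse: "central x \<Longrightarrow> x * y \<simeq>\<^sub>U 1 \<Longrightarrow> y * x \<simeq>\<^sub>U 1 \<Longrightarrow> central y"
  unfolding central_def using commute_inverse by blast

lemma central_add: "central x \<Longrightarrow> central y \<Longrightarrow> central (x + y)"
  by (simp add: central_def distrib_left distrib_right cong_add)

lemma central_mult: "central x \<Longrightarrow> central y \<Longrightarrow> central (x * y)"
  unfolding central_def using commute_mult cong_sym by blast

lemma central_scalar: "central (scalar c)"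
  by (simp add: central_def scalar_commute)

lemma central_power: "central x \<Longrightarrow> central (x ^ n)"
  using central_scalar[of 1] by (induction n) (simp_all add: central_mult)

lemma central_uminus: "central x \<Longrightarrow> central (- x)"
  using central_mult[OF central_scalar[of "- 1"]] by (simp add: scalar_minus)

lemma central_G: "central G"
proof (rule centralI)
  fix s
  have "G * Ki \<simeq>\<^sub>U Ki * G" "G * Gi \<simeq>\<^sub>U Gi * G" "G * Hi \<simeq>\<^sub>U Hi * G"
    using cong_sym[OF commute_inverse[OF cong_sym[OF defining_relations(10)] defining_relations(1,2)]]
      cong_trans[OF defining_relations(3) cong_sym[OF defining_relations(4)]]
      cong_sym[OF commute_inverse[OF cong_sym[OF defining_relations(7)] defining_relations(5,6)]]
    by blast+
  then show "G * free_gen s \<simeq>\<^sub>U free_gen s * G"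
    using defining_relations by (cases s) simp_all
qed

lemma central_H: "central H"
proof (rule centralI)
  fix s
  have "H * G \<simeq>\<^sub>U G * H" "H * Ki \<simeq>\<^sub>U Ki * H" "H * Gi \<simeq>\<^sub>U Gi * H" "H * Hi \<simeq>\<^sub>U Hi * H"
    using cong_sym[OF defining_relations(7)]
      cong_sym[OF commute_inverse[OF cong_sym[OF defining_relations(13)] defining_relations(1,2)]]
      cong_sym[OF commute_inverse[OF defining_relations(7) defining_relations(3,4)]]
      cong_trans[OF defining_relations(5) cong_sym[OF defining_relations(6)]]
    by blast+
  then show "H * free_gen s \<simeq>\<^sub>U free_gen s * H"
    using defining_relations by (cases s) simp_all
qed

lemma central_Gi: "central Gi"
  by (rule central_inverse[OF central_G defining_relations(3,4)])

lemma central_Hi: "central Hi"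
  by (rule central_inverse[OF central_H defining_relations(5,6)])

text \<open>Integer powers, where \<open>y\<close> plays the inverse of \<open>x\<close>.\<close>

definition ipow :: "(generator, 'k) free_algebra \<Rightarrow> (generator, 'k) free_algebra \<Rightarrow> int
    \<Rightarrow> (generator, 'k) free_algebra"
  where "ipow x y i = (if i \<ge> 0 then x ^ nat i else y ^ nat (- i))"

lemma ipow_0 [simp]: "ipow x y 0 = 1"
  by (simp add: ipow_def)

lemma ipow_succ:
  assumes "x * y \<simeq>\<^sub>U 1"
  shows "x * ipow x y i \<simeq>\<^sub>U ipow x y (i + 1)"
proof (cases "i \<ge> 0")
  case True
  then show ?thesis by (simp add: ipow_def nat_add_distrib)
next
  case False
  then obtain j where i: "i = - int (Suc j)"
    by (cases i rule: int_cases) auto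
  have "x * ipow x y i = (x * y) * y ^ j"
    by (simp add: i ipow_def nat_add_distrib mult.assoc del: of_nat_Suc)
  also have "\<dots> \<simeq>\<^sub>U 1 * y ^ j" by (rule cong_right[OF assms])
  also have "\<dots> = ipow x y (i + 1)" by (simp add: i ipow_def)
  finally show ?thesis .
qed

lemma ipow_pred:
  assumes "y * x \<simeq>\<^sub>U 1"
  shows "y * ipow x y i \<simeq>\<^sub>U ipow x y (i - 1)"
proof -
  have swap: "ipow x y j = ipow y x (- j)" for j by (simp add: ipow_def)
  show ?thesis using ipow_succ[OF assms, of "- i"] by (simp add: swap[of i] swap[of "i - 1"])
qed

lemma central_ipow: "central x \<Longrightarrow> central y \<Longrightarrow> central (ipow x y i)"
  by (simp add: ipow_def central_power)

lemma central_left_commute: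
  assumes "central x"
  shows "y * (x * z) \<simeq>\<^sub>U x * (y * z)"
  using cong_right[OF cong_sym[OF centralD[OF assms]], of y z] by (simp add: mult.assoc)

lemma skew_power:
  assumes "x * y \<simeq>\<^sub>U scalar c * (y * x)"
  shows "x * y ^ n \<simeq>\<^sub>U scalar (c ^ n) * (y ^ n * x)"
proof (induction n)
  case (Suc n)
  have "x * y ^ Suc n = (x * y) * y ^ n" by (simp add: mult.assoc)
  also have "\<dots> \<simeq>\<^sub>U scalar c * (y * x) * y ^ n" by (rule cong_right[OF assms])
  also have "\<dots> = scalar c * y * (x * y ^ n)" by (simp add: mult.assoc)
  also have "\<dots> \<simeq>\<^sub>U scalar c * y * (scalar (c ^ n) * (y ^ n * x))" by (rule cong_left[OF Suc])
  also have "\<dots> = scalar (c ^ Suc n) * (y ^ Suc n * x)"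
    by (simp add: scalar_mult scalar_left_commute[of y] mult.assoc)
  finally show ?case .
qed simp

text \<open>
  Applied to \<open>x = K\<close> and \<open>y = K\<^sup>-\<^sup>1\<close>, this turns the defining relations of the form
  \<open>K z K\<^sup>-\<^sup>1 = c z\<close> into rules that exchange two adjacent letters.
\<close>

lemma skew_of_conjugate:
  assumes "x * z * y \<simeq>\<^sub>U scalar c * z" and "x * y \<simeq>\<^sub>U 1" and "y * x \<simeq>\<^sub>U 1" and "c \<noteq> 0"
  shows "x * z \<simeq>\<^sub>U scalar c * (z * x)"
    and "y * z \<simeq>\<^sub>U scalar (inverse c) * (z * y)"
    and "z * x \<simeq>\<^sub>U scalar (inverse c) * (x * z)"
    and "z * y \<simeq>\<^sub>U scalar c * (y * z)"
proof -
  have cancel: "scalar (inverse c) * (scalar c * u) = u" "scalar c * (scalar (inverse c) * u) = u"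
    for u :: "(generator, 'k) free_algebra"
    using assms(4) scalar_mult[of "inverse c" c, symmetric] scalar_mult[of c "inverse c", symmetric]
    by (metis mult.assoc left_inverse mult_1 scalar_1, metis mult.assoc right_inverse mult_1 scalar_1)
  have "x * z = x * z * 1" by simp
  also have "\<dots> \<simeq>\<^sub>U x * z * (y * x)" by (rule cong_left[OF cong_sym[OF assms(3)]])
  also have "\<dots> = x * z * y * x" by (simp add: mult.assoc)
  also have "\<dots> \<simeq>\<^sub>U scalar c * z * x" by (rule cong_right[OF assms(1)])
  finally show xz: "x * z \<simeq>\<^sub>U scalar c * (z * x)" by (simp add: mult.assoc)
  show "z * x \<simeq>\<^sub>U scalar (inverse c) * (x * z)"
    using cong_left[OF cong_sym[OF xz], of "scalar (inverse c)"] by (simp add: cancel)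
  have "z * y = 1 * (z * y)" by simp
  also have "\<dots> \<simeq>\<^sub>U (y * x) * (z * y)" by (rule cong_right[OF cong_sym[OF assms(3)]])
  also have "\<dots> = y * (x * z * y)" by (simp add: mult.assoc)
  also have "\<dots> \<simeq>\<^sub>U y * (scalar c * z)" by (rule cong_left[OF assms(1)])
  also have "\<dots> = scalar c * (y * z)" by (rule scalar_left_commute)
  finally show zy: "z * y \<simeq>\<^sub>U scalar c * (y * z)" .
  show "y * z \<simeq>\<^sub>U scalar (inverse c) * (z * y)"
    using cong_left[OF cong_sym[OF zy], of "scalar (inverse c)"] by (simp add: cancel)
qed

lemma skew_ipow:
  assumes "z * x \<simeq>\<^sub>U scalar c * (x * z)" and "z * y \<simeq>\<^sub>U scalar d * (y * z)"
  shows "\<exists>e. z * ipow x y i \<simeq>\<^sub>U scalar e * (ipow x y i * z)"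
proof (cases "i \<ge> 0")
  case True
  then show ?thesis unfolding ipow_def using skew_power[OF assms(1), of "nat i"] by auto
next
  case False
  then show ?thesis unfolding ipow_def using skew_power[OF assms(2), of "nat (- i)"] by auto
qed

section \<open>The monomial basis\<close>

fun pbw_monomial :: "pbw_index \<Rightarrow> (generator, 'k) free_algebra"
  where "pbw_monomial (a, l, b, m, n) = ipow G Gi m * (ipow H Hi n * (F ^ a * (ipow K Ki l * E ^ b)))"

definition pbw_sum :: "(pbw_index \<Rightarrow> 'k) \<Rightarrow> (generator, 'k) free_algebra"
  where "pbw_sum f = (\<Sum>t | f t \<noteq> 0. scalar (f t) * pbw_monomial t)"

definition pbw_span :: "(generator, 'k) free_algebra set"
  where "pbw_span = {x. \<exists>f. finite {t. f t \<noteq> 0} \<and> x \<simeq>\<^sub>U pbw_sum f}"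

lemma pbw_sum_superset:
  assumes "finite T" and "{t. f t \<noteq> 0} \<subseteq> T"
  shows "pbw_sum f = (\<Sum>t\<in>T. scalar (f t) * pbw_monomial t)"
  unfolding pbw_sum_def using assms by (intro sum.mono_neutral_left) auto

lemma span_cong: "x \<in> pbw_span \<Longrightarrow> y \<simeq>\<^sub>U x \<Longrightarrow> y \<in> pbw_span"
  unfolding pbw_span_def using cong_trans by blast

lemma span_scaled_monomial: "scalar c * pbw_monomial t \<in> pbw_span"
proof -
  let ?f = "\<lambda>i. if i = t then c else 0"
  have "pbw_sum ?f = (\<Sum>i\<in>{t}. scalar (?f i) * pbw_monomial i)"
    by (rule pbw_sum_superset) auto
  moreover have "finite {i. ?f i \<noteq> 0}" by (rule finite_subset[of _ "{t}"]) auto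
  ultimately show ?thesis unfolding pbw_span_def by (auto intro!: exI[of _ ?f])
qed

lemma span_add:
  assumes "x \<in> pbw_span" and "y \<in> pbw_span"
  shows "x + y \<in> pbw_span"
proof -
  obtain f g where f: "finite {t. f t \<noteq> 0}" "x \<simeq>\<^sub>U pbw_sum f"
    and g: "finite {t. g t \<noteq> 0}" "y \<simeq>\<^sub>U pbw_sum g"
    using assms unfolding pbw_span_def by blast
  let ?T = "{t. f t \<noteq> 0} \<union> {t. g t \<noteq> 0}"
  have T: "finite ?T" using f g by simp
  have sub: "{t. f t + g t \<noteq> 0} \<subseteq> ?T" by auto
  have "pbw_sum f + pbw_sum g = pbw_sum (\<lambda>t. f t + g t)"
    using pbw_sum_superset[OF T sub] pbw_sum_superset[OF T, of f] pbw_sum_superset[OF T, of g]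
    by (simp add: scalar_add distrib_right sum.distrib)
  then have "x + y \<simeq>\<^sub>U pbw_sum (\<lambda>t. f t + g t)" using cong_add f g by metis
  then show ?thesis
    using finite_subset[OF sub T] unfolding pbw_span_def
    by (intro CollectI exI[of _ "\<lambda>t. f t + g t"]) simp
qed

lemma span_0: "0 \<in> pbw_span"
  using span_scaled_monomial[of 0] by simp

lemma span_sum: "(\<And>t. t \<in> T \<Longrightarrow> x t \<in> pbw_span) \<Longrightarrow> sum x T \<in> pbw_span"
  by (induction T rule: infinite_finite_induct) (simp_all add: span_0 span_add)

text \<open>
  The span of the monomials is shown to be everything by proving that it is stable under left
  multiplication by each letter and contains \<open>1\<close>.
\<close>

definition stable :: "(generator, 'k) free_algebra \<Rightarrow> bool"
  where "stable y \<longleftrightarrow> (\<forall>x\<in>pbw_span. y * x \<in> pbw_span)"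

lemma stable_scalar: "stable (scalar c)"
  unfolding stable_def
proof
  fix x assume "x \<in> pbw_span"
  then obtain f where f: "finite {t. f t \<noteq> 0}" "x \<simeq>\<^sub>U pbw_sum f"
    unfolding pbw_span_def by blast
  have "scalar c * pbw_sum f \<in> pbw_span"
    unfolding pbw_sum_def sum_distrib_left
    by (intro span_sum) (simp flip: mult.assoc scalar_mult add: span_scaled_monomial)
  then show "scalar c * x \<in> pbw_span" using span_cong cong_left f(2) by blast
qed

lemma stable_add: "stable x \<Longrightarrow> stable y \<Longrightarrow> stable (x + y)"
  by (simp add: stable_def distrib_right span_add)

lemma stable_mult: "stable x \<Longrightarrow> stable y \<Longrightarrow> stable (x * y)"
  by (simp add: stable_def mult.assoc)

lemma stableI:
  assumes "\<And>t. y * pbw_monomial t \<in> pbw_span"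
  shows "stable y"
  unfolding stable_def
proof
  fix x assume "x \<in> pbw_span"
  then obtain f where f: "finite {t. f t \<noteq> 0}" "x \<simeq>\<^sub>U pbw_sum f"
    unfolding pbw_span_def by blast
  have "y * pbw_sum f \<in> pbw_span"
    unfolding pbw_sum_def sum_distrib_left
    using stable_scalar assms by (intro span_sum) (simp add: scalar_left_commute stable_def)
  then show "y * x \<in> pbw_span" using span_cong cong_left f(2) by blast
qed

lemma stableI_monomial:
  assumes "\<And>a l b m n. \<exists>c u. y * pbw_monomial (a, l, b, m, n) \<simeq>\<^sub>U scalar c * pbw_monomial u"
  shows "stable y"
proof (rule stableI)
  fix t :: pbw_index
  obtain a l b m n where "t = (a, l, b, m, n)" by (cases t)
  then show "y * pbw_monomial t \<in> pbw_span"
    using assms[of a l b m n] span_scaled_monomial span_cong by metis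
qed

text \<open>
  The central factors stand first in a monomial, so a relation for the remaining part applies to
  the whole.
\<close>

lemma push_through_grouplikes:
  assumes "x * z \<simeq>\<^sub>U w"
  shows "x * (ipow G Gi m * (ipow H Hi n * z)) \<simeq>\<^sub>U ipow G Gi m * (ipow H Hi n * w)"
proof -
  have "x * (ipow G Gi m * (ipow H Hi n * z)) \<simeq>\<^sub>U ipow G Gi m * (x * (ipow H Hi n * z))"
    by (intro central_left_commute central_ipow central_G central_Gi)
  also have "\<dots> \<simeq>\<^sub>U ipow G Gi m * (ipow H Hi n * (x * z))"
    by (intro cong_left central_left_commute central_ipow central_H central_Hi)
  also have "\<dots> \<simeq>\<^sub>U ipow G Gi m * (ipow H Hi n * w)"
    by (intro cong_left assms)
  finally show ?thesis .
qed

lemma F_monomial: "F * pbw_monomial (a, l, b, m, n) \<simeq>\<^sub>U pbw_monomial (Suc a, l, b, m, n)"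
  unfolding pbw_monomial.simps by (rule push_through_grouplikes) (simp add: mult.assoc)

lemma stable_grouplike: "stable G" "stable Gi" "stable H" "stable Hi"
proof -
  have G: "x * pbw_monomial (a, l, b, m, n) \<simeq>\<^sub>U pbw_monomial (a, l, b, m', n)"
    if "x * ipow G Gi m \<simeq>\<^sub>U ipow G Gi m'" for x a l b m n m'
    using cong_right[OF that] by (simp add: mult.assoc)
  have H: "x * pbw_monomial (a, l, b, m, n) \<simeq>\<^sub>U pbw_monomial (a, l, b, m, n')"
    if "x * ipow H Hi n \<simeq>\<^sub>U ipow H Hi n'" for x a l b m n n'
  proof -
    let ?r = "F ^ a * (ipow K Ki l * E ^ b)"
    have "x * pbw_monomial (a, l, b, m, n) \<simeq>\<^sub>U ipow G Gi m * (x * (ipow H Hi n * ?r))"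
      unfolding pbw_monomial.simps
      by (intro central_left_commute central_ipow central_G central_Gi)
    also have "\<dots> = ipow G Gi m * ((x * ipow H Hi n) * ?r)" by (simp add: mult.assoc)
    also have "\<dots> \<simeq>\<^sub>U ipow G Gi m * (ipow H Hi n' * ?r)" by (intro cong_left cong_right that)
    finally show ?thesis by simp
  qed
  have scaled: "x \<simeq>\<^sub>U y \<Longrightarrow> x \<simeq>\<^sub>U scalar 1 * y" for x y by simp
  show "stable G"
    by (rule stableI_monomial)
      (use scaled[OF G[OF ipow_succ[OF defining_relations(3)]]] in blast)
  show "stable Gi"
    by (rule stableI_monomial)
      (use scaled[OF G[OF ipow_pred[OF defining_relations(4)]]] in blast)
  show "stable H"
    by (rule stableI_monomial)
      (use scaled[OF H[OF ipow_succ[OF defining_relations(5)]]] in blast)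
  show "stable Hi"
    by (rule stableI_monomial)
      (use scaled[OF H[OF ipow_pred[OF defining_relations(6)]]] in blast)
qed

lemma stable_F: "stable F"
proof (rule stableI)
  fix t :: pbw_index
  obtain a l b m n where "t = (a, l, b, m, n)" by (cases t)
  then show "F * pbw_monomial t \<in> pbw_span"
    using span_cong[OF _ F_monomial] span_scaled_monomial[of 1 "(Suc a, l, b, m, n)"]
    by (simp del: pbw_monomial.simps)
qed

text \<open>
  The common argument for \<open>K\<close> and its inverse: either of them passes \<open>F\<^sup>a\<close> at the cost of a
  scalar and is then absorbed by the power of \<open>K\<close>.
\<close>

lemma stable_torus:
  assumes "x * F \<simeq>\<^sub>U scalar c * (F * x)" and "\<And>l. x * ipow K Ki l \<simeq>\<^sub>U ipow K Ki (l' l)"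
  shows "stable x"
proof (rule stableI_monomial)
  fix a l b m n
  let ?r = "ipow K Ki l * E ^ b"
  have "x * (F ^ a * ?r) = (x * F ^ a) * ?r" by (simp add: mult.assoc)
  also have "\<dots> \<simeq>\<^sub>U scalar (c ^ a) * (F ^ a * x) * ?r"
    by (rule cong_right[OF skew_power[OF assms(1)]])
  also have "\<dots> = scalar (c ^ a) * (F ^ a * ((x * ipow K Ki l) * E ^ b))" by (simp add: mult.assoc)
  also have "\<dots> \<simeq>\<^sub>U scalar (c ^ a) * (F ^ a * (ipow K Ki (l' l) * E ^ b))"
    by (intro cong_left cong_right assms(2))
  finally have "x * pbw_monomial (a, l, b, m, n)
      \<simeq>\<^sub>U ipow G Gi m * (ipow H Hi n * (scalar (c ^ a) * (F ^ a * (ipow K Ki (l' l) * E ^ b))))"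
    unfolding pbw_monomial.simps by (rule push_through_grouplikes)
  also have "\<dots> = scalar (c ^ a) * pbw_monomial (a, l' l, b, m, n)"
    by (simp add: scalar_left_commute)
  finally show "\<exists>c u. x * pbw_monomial (a, l, b, m, n) \<simeq>\<^sub>U scalar c * pbw_monomial u" by blast
qed

lemmas K_inverse = defining_relations(1,2)

lemma stable_K: "stable K" and stable_Ki: "stable Ki"
proof -
  have "inverse q ^ 2 \<noteq> 0" using q_nonzero by simp
  note skew = skew_of_conjugate[OF KFKi K_inverse this]
  show "stable K" by (rule stable_torus[OF skew(1)]) (rule ipow_succ[OF K_inverse(1)])
  show "stable Ki" by (rule stable_torus[OF skew(2)]) (rule ipow_pred[OF K_inverse(2)])
qed

text \<open>
  Induction on the exponent of \<open>F\<close>: one factor \<open>E F\<close> is replaced by \<open>F E\<close> plus a term in \<open>K\<close>,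
  \<open>K\<^sup>-\<^sup>1\<close> and \<open>g\<close>. These letters are already known to preserve the span, and \<open>E\<close> now acts on a monomial
  with a smaller exponent.
\<close>

lemma stable_E: "stable E"
proof (rule stableI)
  have "q ^ 2 \<noteq> 0" using q_nonzero by simp
  note skew = skew_of_conjugate[OF KEKi K_inverse this]
  have mon: "E * pbw_monomial (a, l, b, m, n) \<in> pbw_span" for a b :: nat and l m n :: int
  proof (induction a)
    case 0
    obtain e where e: "E * ipow K Ki l \<simeq>\<^sub>U scalar e * (ipow K Ki l * E)"
      using skew_ipow[OF skew(3,4)] by blast
    have "E * (F ^ 0 * (ipow K Ki l * E ^ b)) = (E * ipow K Ki l) * E ^ b"
      by (simp add: mult.assoc)
    also have "\<dots> \<simeq>\<^sub>U scalar e * (ipow K Ki l * E) * E ^ b" by (rule cong_right[OF e])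
    finally have "E * pbw_monomial (0, l, b, m, n)
        \<simeq>\<^sub>U ipow G Gi m * (ipow H Hi n * (scalar e * (ipow K Ki l * E) * E ^ b))"
      unfolding pbw_monomial.simps by (rule push_through_grouplikes)
    also have "\<dots> = scalar e * pbw_monomial (0, l, Suc b, m, n)"
      by (simp add: scalar_left_commute mult.assoc)
    finally show ?case using span_cong span_scaled_monomial by blast
  next
    case (Suc a)
    let ?M = "pbw_monomial (a, l, b, m, n)" and ?c = "scalar (1 / (q - inverse q))"
    have "E * pbw_monomial (Suc a, l, b, m, n) \<simeq>\<^sub>U E * (F * ?M)"
      by (intro cong_left cong_sym[OF F_monomial])
    also have "\<dots> = E * F * ?M" by (simp add: mult.assoc)
    also have "\<dots> \<simeq>\<^sub>U (F * E + ?c * (K - Ki * G ^ 2)) * ?M" by (rule cong_right[OF EF])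
    also have "\<dots> = F * (E * ?M) + ?c * (K + scalar (- 1) * (Ki * (G * G))) * ?M"
      by (simp add: algebra_simps power2_eq_square scalar_minus)
    finally have eq: "E * pbw_monomial (Suc a, l, b, m, n)
      \<simeq>\<^sub>U F * (E * ?M) + ?c * (K + scalar (- 1) * (Ki * (G * G))) * ?M" .
    have "?M \<in> pbw_span"
      using span_scaled_monomial[of 1 "(a, l, b, m, n)"] by (simp del: pbw_monomial.simps)
    moreover have "stable (?c * (K + scalar (- 1) * (Ki * (G * G))))"
      by (intro stable_mult stable_add stable_scalar stable_K stable_Ki stable_grouplike)
    ultimately show ?case
      using Suc stable_F span_cong[OF span_add eq] unfolding stable_def by blast
  qed
  show "E * pbw_monomial t \<in> pbw_span" for t by (cases t) (simp only: mon)
qed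

lemma pbw_spanning: "x \<in> pbw_span"
proof -
  have letters: "stable (free_gen s)" for s
    by (cases s) (simp_all add: stable_E stable_F stable_K stable_Ki stable_grouplike)
  have "stable x"
  proof (induction x rule: free_algebra_induct)
  qed (simp_all add: stable_scalar stable_add stable_mult letters)
  moreover have "1 \<in> pbw_span" using span_scaled_monomial[of 1 "(0, 0, 0, 0, 0)"] by simp
  ultimately show ?thesis unfolding stable_def by fastforce
qed

definition delta :: "pbw_index \<Rightarrow> pbw_index \<Rightarrow> 'k"
  where "delta t = (\<lambda>i. if i = t then 1 else 0)"

text \<open>
  The function \<open>delta (0, 0, 0, 0, 0)\<close> is the expansion of \<open>1\<close>, so acting on it yields the
  expansion of \<open>x\<close> in monomials. This reading is justified by \<open>cong_pbw_sum_coef\<close> below.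
\<close>

definition coef :: "(generator, 'k) free_algebra \<Rightarrow> pbw_index \<Rightarrow> 'k"
  where "coef x = rep (pbw_op q) x (delta (0, 0, 0, 0, 0))"

lemma rep_sum: "rep (pbw_op q) (sum x T) v = (\<lambda>i. \<Sum>t\<in>T. rep (pbw_op q) (x t) v i)"
  using rep_scalar[of "pbw_op q" 0 v]
  by (induction T rule: infinite_finite_induct) (simp_all add: rep_add)

lemma pbw_op_delta:
  "pbw_op q gen_F (delta (a, l, b, m, n)) = delta (Suc a, l, b, m, n)"
  "pbw_op q gen_g (delta (a, l, b, m, n)) = delta (a, l, b, m + 1, n)"
  "pbw_op q gen_gi (delta (a, l, b, m, n)) = delta (a, l, b, m - 1, n)"
  "pbw_op q gen_h (delta (a, l, b, m, n)) = delta (a, l, b, m, n + 1)"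
  "pbw_op q gen_hi (delta (a, l, b, m, n)) = delta (a, l, b, m, n - 1)"
  "pbw_op q gen_K (delta (0, l, b, m, n)) = delta (0, l + 1, b, m, n)"
  "pbw_op q gen_Ki (delta (0, l, b, m, n)) = delta (0, l - 1, b, m, n)"
  "pbw_op q gen_E (delta (0, 0, b, m, n)) = delta (0, 0, Suc b, m, n)"
  by (auto simp: fun_eq_iff delta_def split: nat.splits)

lemma rep_ipow:
  assumes "\<And>i. pbw_op q s (d i) = d (i + 1)" and "\<And>i. pbw_op q s' (d i) = d (i - 1)"
  shows "rep (pbw_op q) (ipow (free_gen s) (free_gen s') i) (d 0) = d i"
proof -
  have "(pbw_op q s ^^ k) (d 0) = d (int k)" "(pbw_op q s' ^^ k) (d 0) = d (- int k)" for k
    by (induction k) (simp_all add: assms add.commute minus_diff_commute)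
  moreover have "rep (pbw_op q) (free_gen s) = pbw_op q s" for s
    by (rule ext) (rule rep_gen[OF linear_pbw_op])
  ultimately show ?thesis by (simp add: ipow_def rep_power[OF linear_pbw_op])
qed

lemma rep_grouplikes:
  "rep (pbw_op q) (ipow G Gi m * ipow H Hi n) (delta (a, l, b, 0, 0)) = delta (a, l, b, m, n)"
  using rep_ipow[of gen_h "\<lambda>n. delta (a, l, b, 0, n)" gen_hi n]
    rep_ipow[of gen_g "\<lambda>m. delta (a, l, b, m, n)" gen_gi m]
  by (simp add: rep_simps pbw_op_delta)

lemma coef_pbw_monomial: "coef (pbw_monomial t) = delta t"
proof -
  obtain a l b m n where t: "t = (a, l, b, m, n)" by (cases t)
  have gen: "rep (pbw_op q) (free_gen s) = pbw_op q s" for s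
    by (rule ext) (rule rep_gen[OF linear_pbw_op])
  have E: "(pbw_op q gen_E ^^ b) (delta (0, 0, 0, 0, 0)) = delta (0, 0, b, 0, 0)"
    by (induction b) (simp_all add: pbw_op_delta)
  have F: "(pbw_op q gen_F ^^ a) (delta (0, l, b, 0, 0)) = delta (a, l, b, 0, 0)"
    by (induction a) (simp_all add: pbw_op_delta)
  have K: "rep (pbw_op q) (ipow K Ki l) (delta (0, 0, b, 0, 0)) = delta (0, l, b, 0, 0)"
    using rep_ipow[of gen_K "\<lambda>l. delta (0, l, b, 0, 0)" gen_Ki l] by (simp add: pbw_op_delta)
  have "pbw_monomial t = (ipow G Gi m * ipow H Hi n) * (F ^ a * (ipow K Ki l * E ^ b))"
    by (simp add: t mult.assoc)
  then show ?thesis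
    unfolding coef_def t
    by (simp only: rep_mult[OF linear_pbw_op, where x = "ipow G Gi m * ipow H Hi n"] rep_grouplikes
        rep_mult[OF linear_pbw_op, where x = "F ^ a"] rep_mult[OF linear_pbw_op, where x = "ipow K Ki l"]
        rep_power[OF linear_pbw_op] gen E F K)
qed

lemma coef_mult: "coef (x * y) = rep (pbw_op q) x (coef y)"
  by (simp add: coef_def rep_mult[OF linear_pbw_op])

lemma coef_sum: "coef (sum x T) i = (\<Sum>t\<in>T. coef (x t) i)"
  by (simp add: coef_def rep_sum)

lemma coef_scalar_mult: "coef (scalar c * x) i = c * coef x i"
  by (simp add: coef_mult rep_scalar)

lemma coef_pbw_sum:
  assumes "finite {t. f t \<noteq> 0}"
  shows "coef (pbw_sum f) = f"
proof
  fix i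
  have "coef (pbw_sum f) i = (\<Sum>t | f t \<noteq> 0. f t * delta t i)"
    by (simp add: pbw_sum_def coef_sum coef_scalar_mult coef_pbw_monomial)
  also have "\<dots> = (\<Sum>t | f t \<noteq> 0. if t = i then f t else 0)"
    by (rule sum.cong) (auto simp: delta_def)
  also have "\<dots> = f i" using assms by simp
  finally show "coef (pbw_sum f) i = f i" .
qed

lemma cong_pbw_sum_coef: "finite {t. coef x t \<noteq> 0}" "x \<simeq>\<^sub>U pbw_sum (coef x)"
proof -
  obtain f where f: "finite {t. f t \<noteq> 0}" "x \<simeq>\<^sub>U pbw_sum f"
    using pbw_spanning[of x] unfolding pbw_span_def by blast
  then have "coef x = f" using coef_pbw_sum cong_rep unfolding coef_def by metis
  then show "finite {t. coef x t \<noteq> 0}" "x \<simeq>\<^sub>U pbw_sum (coef x)" using f by simp_all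
qed

text \<open>
  Spanning recovers \<open>x\<close> from its coefficients, and the action, hence the coefficients, depend only on
  the class of \<open>x\<close>. So the monomials form a basis of the quotient.
\<close>

lemma cong_iff_coef: "x \<simeq>\<^sub>U y \<longleftrightarrow> coef x = coef y"
proof
  assume "coef x = coef y"
  then show "x \<simeq>\<^sub>U y"
    using cong_trans[OF cong_pbw_sum_coef(2)[of x]] cong_sym[OF cong_pbw_sum_coef(2)[of y]] by simp
qed (simp add: coef_def cong_rep)

lemma coef_diff: "coef (x - y) t = coef x t - coef y t"
  by (simp add: coef_def rep_diff[OF linear_pbw_op])

section \<open>The Casimir element\<close>

lemma q_minus_inverse: "q - inverse q \<noteq> 0"
proof
  assume "q - inverse q = 0"
  then have "q ^ 2 = 1" using q_nonzero by (simp add: field_simps power2_eq_square)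
  then show False using not_root[of 2] by simp
qed

lemma rep_casimir:
  "rep (pbw_op q) (casimir q) v = (\<lambda>i. pbw_op q gen_F (pbw_op q gen_E v) i
    + (q / (q - inverse q) ^ 2 * pbw_op q gen_K v i
    + inverse q / (q - inverse q) ^ 2 * pbw_op q gen_Ki (pbw_op q gen_g (pbw_op q gen_g v)) i))"
  by (simp add: casimir_def rep_simps field_simps)

lemma cong_iff_rep: "x \<simeq>\<^sub>U y \<longleftrightarrow> (\<forall>v. rep (pbw_op q) x v = rep (pbw_op q) y v)"
  using cong_rep cong_iff_coef unfolding coef_def by metis

text \<open>
  In \<open>C E\<close> versus \<open>E C\<close>, the products \<open>F E E\<close> and \<open>E F E\<close> differ by \<open>r (K - K\<^sup>-\<^sup>1 g\<^sup>2) E\<close> with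
  \<open>r = 1 / (q - q\<^sup>-\<^sup>1)\<close>. The correction term of \<open>C\<close> has coefficients \<open>s1\<close> and \<open>s2\<close>, and moving
  \<open>E\<close> past \<open>K\<close> and \<open>K\<^sup>-\<^sup>1\<close> interchanges them; so the two differences cancel because
  \<open>s1 - s2 = r\<close>. The case of \<open>F\<close> is symmetric. The computation takes place in the representation,
  where the scalars are coefficients of functions and arithmetic in the field settles it.
\<close>

lemma central_casimir: "central (casimir q)"
proof (rule centralI)
  fix s
  let ?e = "pbw_op q gen_E" and ?f = "pbw_op q gen_F" and ?k = "pbw_op q gen_K"
    and ?ki = "pbw_op q gen_Ki" and ?g = "pbw_op q gen_g"
  define r s1 s2 where "r = 1 / (q - inverse q)" and "s1 = q / (q - inverse q) ^ 2"
    and "s2 = inverse q / (q - inverse q) ^ 2"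
  note rs = this
  have s_shift: "s1 * (inverse (q ^ 2) * x) = s2 * x" "s2 * (q ^ 2 * x) = s1 * x" for x
    using q_nonzero by (simp_all add: rs power2_eq_square)
  have s_diff: "s1 = r + s2"
    using q_minus_inverse diff_divide_distrib[of q "inverse q" "(q - inverse q) ^ 2"]
    by (simp add: rs power2_eq_square)
  note cas = rep_casimir[folded rs]
  have q2: "q ^ 2 \<noteq> 0" "inverse q ^ 2 \<noteq> 0" using q_nonzero by simp_all
  note skewE = skew_of_conjugate[OF KEKi K_inverse q2(1)]
    and skewF = skew_of_conjugate[OF KFKi K_inverse q2(2)]
  have ef: "?e (?f v) = (\<lambda>i. ?f (?e v) i + r * (?k v i - ?ki (?g (?g v)) i))" for v
    using cong_rep[OF EF, of v] by (simp add: rep_simps rs)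
  have ek: "?e (?k v) = (\<lambda>i. inverse (q ^ 2) * ?k (?e v) i)"
    and eki: "?e (?ki v) = (\<lambda>i. q ^ 2 * ?ki (?e v) i)"
    and kf: "?k (?f v) = (\<lambda>i. inverse (q ^ 2) * ?f (?k v) i)"
    and kif: "?ki (?f v) = (\<lambda>i. q ^ 2 * ?f (?ki v) i)" for v
    using cong_rep[OF skewE(3), of v] cong_rep[OF skewE(4), of v]
      cong_rep[OF skewF(1), of v] cong_rep[OF skewF(2), of v]
    by (simp_all add: rep_simps power_inverse)
  have eg: "?e (?g v) = ?g (?e v)" and fg: "?f (?g v) = ?g (?f v)"
    and kg: "?k (?g v) = ?g (?k v)" and kig: "?ki (?g v) = ?g (?ki v)" for v
    using cong_rep[OF centralD[OF central_G], of E v] cong_rep[OF centralD[OF central_G], of F v]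
      cong_rep[OF centralD[OF central_G], of K v] cong_rep[OF centralD[OF central_G], of Ki v]
    by (simp_all add: rep_simps)
  have kki: "?k (?ki v) = v" "?ki (?k v) = v" for v
    using cong_rep[OF K_inverse(1), of v] cong_rep[OF K_inverse(2), of v]
    by (simp_all add: rep_simps)
  note lin = linear_opD(1,2)[OF linear_pbw_op] linear_op_diff[OF linear_pbw_op]
  note rules = rep_simps cas lin eg fg kg kig kki s_shift
  have E: "casimir q * E \<simeq>\<^sub>U E * casimir q"
    unfolding cong_iff_rep
    by (simp add: rules ef ek eki del: pbw_op.simps) (simp add: s_diff algebra_simps del: pbw_op.simps)
  have F: "casimir q * F \<simeq>\<^sub>U F * casimir q"
    unfolding cong_iff_rep
    by (simp add: rules ef kf kif del: pbw_op.simps) (simp add: s_diff algebra_simps del: pbw_op.simps)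
  have K: "casimir q * K \<simeq>\<^sub>U K * casimir q"
    unfolding cong_iff_rep
    using q_nonzero by (simp add: rules kf ek del: pbw_op.simps)
  have Ki: "casimir q * Ki \<simeq>\<^sub>U Ki * casimir q"
    by (rule cong_sym[OF commute_inverse[OF cong_sym[OF K] K_inverse]])
  show "casimir q * free_gen s \<simeq>\<^sub>U free_gen s * casimir q"
    using E F K Ki cong_sym[OF centralD[OF central_G]] cong_sym[OF centralD[OF central_Gi]]
      cong_sym[OF centralD[OF central_H]] cong_sym[OF centralD[OF central_Hi]]
    by (cases s) simp_all
qed

section \<open>Determination of the center\<close>

text \<open>
  Right multiplication by \<open>K\<close> and by \<open>E\<close>, on coefficients. They commute with left
  multiplications, so their effect on the expansion of \<open>1\<close> determines them.
\<close>

fun right_K :: "(pbw_index \<Rightarrow> 'k) \<Rightarrow> pbw_index \<Rightarrow> 'k"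
  where "right_K v (a, l, b, m, n) = (inverse q ^ 2) ^ b * v (a, l - 1, b, m, n)"

fun right_E :: "(pbw_index \<Rightarrow> 'k) \<Rightarrow> pbw_index \<Rightarrow> 'k"
  where "right_E v (a, l, b, m, n) = (case b of 0 \<Rightarrow> 0 | Suc b' \<Rightarrow> v (a, l, b', m, n))"

lemma linear_right: "linear_op right_K" "linear_op right_E"
  by (simp_all add: linear_op_def fun_eq_iff algebra_simps split: nat.splits)

lemma right_K_commutes: "right_K (pbw_op q s v) = pbw_op q s (right_K v)"
proof
  fix i :: pbw_index
  show "right_K (pbw_op q s v) i = pbw_op q s (right_K v) i"
    using q_nonzero
    by (cases i; cases s)
      (simp_all add: algebra_simps power_inverse powi_one_minus mult.left_commute split: nat.splits)
qed

lemma right_E_commutes: "right_E (pbw_op q s v) = pbw_op q s (right_E v)"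
proof
  fix i :: pbw_index
  show "right_E (pbw_op q s v) i = pbw_op q s (right_E v) i"
    by (cases i; cases s) (simp_all split: nat.splits)
qed

lemma coef_mult_right:
  shows coef_mult_K: "coef (x * K) = right_K (coef x)"
    and coef_mult_E: "coef (x * E) = right_E (coef x)"
proof -
  let ?d = "delta (0, 0, 0, 0, 0)"
  have "pbw_op q gen_K ?d = right_K ?d" "pbw_op q gen_E ?d = right_E ?d"
    by (auto simp: fun_eq_iff delta_def split: nat.splits intro: gr0I)
  then show "coef (x * K) = right_K (coef x)" "coef (x * E) = right_E (coef x)"
    unfolding coef_def rep_mult[OF linear_pbw_op] rep_gen[OF linear_pbw_op]
    using rep_commute[where L = "pbw_op q", OF linear_pbw_op linear_right(1) right_K_commutes]
      rep_commute[where L = "pbw_op q", OF linear_pbw_op linear_right(2) right_E_commutes] by simp_all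
qed

lemma square_power_eq_1: "(q ^ 2) ^ n = 1 \<Longrightarrow> n = 0"
  using not_root[of "2 * n"] by (auto simp: power_mult)

lemma square_power_inj:
  assumes "(inverse q ^ 2) ^ a = (inverse q ^ 2) ^ b"
  shows "a = b"
proof -
  have eq: "(q ^ 2) ^ a = (q ^ 2) ^ b" using assms by (simp add: power_inverse)
  have "x = y" if "(q ^ 2) ^ x = (q ^ 2) ^ y" "x \<le> y" for x y
  proof -
    have "(q ^ 2) ^ x * (q ^ 2) ^ (y - x) = (q ^ 2) ^ y"
      using that(2) by (simp flip: power_add)
    then have "(q ^ 2) ^ (y - x) = 1" using that q_nonzero by simp
    then show ?thesis using square_power_eq_1 that by fastforce
  qed
  then show ?thesis using eq by (metis linear)
qed

lemma central_coef_diagonal: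
  assumes "central z" and "coef z (a, l, b, m, n) \<noteq> 0"
  shows "a = b"
proof -
  have "right_K (coef z) = pbw_op q gen_K (coef z)"
    using centralD[OF assms(1), of K]
    by (simp add: cong_iff_coef coef_mult_K coef_mult[of K] rep_gen[OF linear_pbw_op])
  from fun_cong[OF this, of "(a, l + 1, b, m, n)"] show ?thesis
    using assms(2) square_power_inj[of a b] by simp
qed

text \<open>
  The coefficients of \<open>E z\<close> and \<open>z E\<close> at \<open>(N, l, N + 1, m, n)\<close> are compared. In \<open>E z\<close> the commutator
  terms have \<open>F\<close>-degree \<open>N\<close> only when they come from degree \<open>N + 1\<close>, where \<open>z\<close> vanishes.
\<close>

lemma central_top_coef:
  assumes "central z" and "coef z (N, l, N, m, n) \<noteq> 0"
    and top: "\<And>a l b m n. a > N \<Longrightarrow> coef z (a, l, b, m, n) = 0"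
  shows "l = 0"
proof -
  have "right_E (coef z) = pbw_op q gen_E (coef z)"
    using centralD[OF assms(1), of E]
    by (simp add: cong_iff_coef coef_mult_E coef_mult[of E] rep_gen[OF linear_pbw_op])
  from fun_cong[OF this, of "(N, l, Suc N, m, n)"]
  have one: "(q ^ 2) powi (- l) = 1"
    using assms(2) top by simp
  then have "(q ^ 2) ^ nat \<bar>l\<bar> = 1"
    by (cases l rule: int_cases2) (simp_all add: power_int_minus)
  then show ?thesis using square_power_eq_1 by fastforce
qed

text \<open>
  Only the summand \<open>F E\<close> of \<open>C\<close> raises the \<open>F\<close>-degree, so the term of degree \<open>N\<close> in the \<open>N\<close>-th power is obtained from
  \<open>F E\<close> alone. No power of \<open>q\<close> appears, since in the top term \<open>E\<close> meets no \<open>K\<close>.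
\<close>

lemma coef_casimir_power:
  assumes "a \<ge> N"
  shows "coef (casimir q ^ N * (ipow G Gi m * ipow H Hi n)) (a, l, b, m', n')
    = delta (N, 0, N, m, n) (a, l, b, m', n')"
  using assms
proof (induction N arbitrary: a l b m' n')
  case 0
  then show ?case using rep_grouplikes[of m n 0 0 0] by (simp add: coef_def)
next
  case (Suc N)
  let ?v = "coef (casimir q ^ N * (ipow G Gi m * ipow H Hi n))"
  obtain a' where a: "a = Suc a'" "N \<le> a'" using Suc.prems by (cases a) auto
  have "coef (casimir q ^ Suc N * (ipow G Gi m * ipow H Hi n)) = rep (pbw_op q) (casimir q) ?v"
    by (simp add: mult.assoc coef_mult)
  then show ?case
    using a by (auto simp: rep_casimir Suc.IH delta_def split: nat.splits)
qed

text \<open>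
  Descent on the \<open>F\<close>-degree. The set \<open>A\<close> is any set of representatives that is closed under the
  operations of the subalgebra; subtracting a suitable element of \<open>A\<close> removes the top part of a central element.
\<close>

lemma central_in_generated:
  assumes zero: "\<And>x. x \<simeq>\<^sub>U 0 \<Longrightarrow> x \<in> A"
    and add: "\<And>x y. x \<in> A \<Longrightarrow> y \<in> A \<Longrightarrow> x + y \<in> A"
    and mult: "\<And>x y. x \<in> A \<Longrightarrow> y \<in> A \<Longrightarrow> x * y \<in> A"
    and scalar: "\<And>c. scalar c \<in> A"
    and gens: "G \<in> A" "Gi \<in> A" "H \<in> A" "Hi \<in> A" "casimir q \<in> A"
    and "central z"
  shows "z \<in> A"
proof -
  have power: "x ^ k \<in> A" if "x \<in> A" for x k
    using scalar[of 1] that by (induction k) (simp_all add: mult)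
  have ipow: "ipow x y i \<in> A" if "x \<in> A" "y \<in> A" for x y i
    using that by (simp add: ipow_def power)
  have sum: "(\<And>t. t \<in> T \<Longrightarrow> x t \<in> A) \<Longrightarrow> sum x T \<in> A" for x :: "int \<times> int \<Rightarrow> _" and T
    using scalar[of 0] by (induction T rule: infinite_finite_induct) (simp_all add: add)
  have main: "x \<in> A" if "central x" "\<And>a l b m n. a \<ge> N \<Longrightarrow> coef x (a, l, b, m, n) = 0" for N x
    using that
  proof (induction N arbitrary: x)
    case 0
    then have "coef x t = coef 0 t" for t
      using rep_scalar[of "pbw_op q" 0] by (cases t) (simp add: coef_def)
    then show ?case by (intro zero) (auto simp: cong_iff_coef)
  next
    case (Suc N)
    let ?v = "coef x"
    \<comment> \<open>The exponents of \<open>g\<close> and \<open>h\<close> that occur in \<open>x\<close>, and the multiple of \<open>C\<^sup>N\<close> with the top part of \<open>x\<close>.\<close>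
    let ?T = "(\<lambda>(a, l, b, m, n). (m, n)) ` {t. ?v t \<noteq> 0}"
    let ?C = "\<lambda>p. casimir q ^ N * (ipow G Gi (fst p) * ipow H Hi (snd p))"
    define y where "y = (\<Sum>p\<in>?T. scalar (?v (N, 0, N, fst p, snd p)) * ?C p)"
    have T: "finite ?T" using cong_pbw_sum_coef(1) by blast
    have "y \<in> A"
      unfolding y_def by (intro sum mult scalar power ipow gens)
    have sum_central: "(\<And>t. t \<in> T \<Longrightarrow> central (x t)) \<Longrightarrow> central (sum x T)"
      for x :: "int \<times> int \<Rightarrow> _" and T
      using central_scalar[of 0]
      by (induction T rule: infinite_finite_induct) (simp_all add: central_add)
    have "central y"
      unfolding y_def
      by (intro sum_central central_mult central_scalar central_power central_ipow
          central_casimir central_G central_Gi central_H central_Hi)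
    have "central (x - y)"
      using central_add[OF Suc.prems(1) central_uminus[OF \<open>central y\<close>]] by simp
    moreover have "coef (x - y) (a, l, b, m, n) = 0" if "a \<ge> N" for a l b m n
    proof -
      have "coef y (a, l, b, m, n)
          = (\<Sum>p\<in>?T. ?v (N, 0, N, fst p, snd p) * delta (N, 0, N, fst p, snd p) (a, l, b, m, n))"
        by (simp only: y_def coef_sum coef_scalar_mult coef_casimir_power[OF that])
      also have "\<dots> = (\<Sum>p\<in>?T. if p = (m, n) then if (a, l, b) = (N, 0, N) then ?v (N, 0, N, m, n) else 0 else 0)"
        by (rule sum.cong) (auto simp: delta_def)
      also have "\<dots> = (if (m, n) \<in> ?T \<and> (a, l, b) = (N, 0, N) then ?v (N, 0, N, m, n) else 0)"
        using T by simp
      also have "\<dots> = ?v (a, l, b, m, n)"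
      proof (cases "?v (a, l, b, m, n) = 0")
        case False
        then have "\<not> a > N" using Suc.prems(2) by (metis Suc_leI)
        then have "a = N" using that by simp
        moreover have "b = N" using central_coef_diagonal[OF Suc.prems(1) False] \<open>a = N\<close> by simp
        moreover have "l = 0"
          using central_top_coef[OF Suc.prems(1), of N l m n] False Suc.prems(2) calculation
          by (simp add: Suc_le_eq)
        moreover have "(m, n) \<in> ?T" using False by force
        ultimately show ?thesis by simp
      qed auto
      finally show ?thesis by (simp add: coef_diff)
    qed
    ultimately have "x - y \<in> A" by (rule Suc.IH)
    then show ?case using add[OF _ \<open>y \<in> A\<close>] by fastforce
  qed
  have "finite (fst ` {t. coef z t \<noteq> 0})" using cong_pbw_sum_coef(1) by blast
  then obtain N where "\<forall>a \<in> fst ` {t. coef z t \<noteq> 0}. a < N"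
    using finite_nat_set_iff_bounded by blast
  then have "coef z (a, l, b, m, n) = 0" if "a \<ge> N" for a l b m n
    using that by force
  then show ?thesis using main \<open>central z\<close> by blast
qed

lemma U_class_in_center_iff: "U_class q x \<in> ring_center (U_gh q) \<longleftrightarrow> central x"
  by (auto simp: ring_center_def carrier_U_gh central_def U_class_eq_iff simp flip: U_class_mult)

lemma center_U_gh:
  "ring_center (U_gh q) =
    generated_subalgebra (\<lambda>c. U_class q (scalar c)) (U_gh q)
      {U_class q G, U_class q Gi, U_class q H, U_class q Hi, U_class q (casimir q)}"
  (is "_ = ?S")
proof
  interpret U: ring "U_gh q" by (rule ring_U_gh)
  show "ring_center (U_gh q) \<subseteq> ?S"
  proof
    fix u assume u: "u \<in> ring_center (U_gh q)"
    then obtain z where z: "u = U_class q z" by (auto simp: ring_center_def carrier_U_gh)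
    have "z \<in> {x. U_class q x \<in> ?S}"
    proof (rule central_in_generated)
      show "x \<in> {x. U_class q x \<in> ?S}" if "x \<simeq>\<^sub>U 0" for x
      proof -
        have "U_class q x = U_class q (scalar 0)" using that by (simp add: U_class_eq_iff)
        moreover have "U_class q (scalar 0) \<in> ?S"
          unfolding generated_subalgebra_def by (intro generate_ring.incl UnI1 rangeI)
        ultimately show ?thesis by simp
      qed
    next
      show "central z" using u by (simp add: z U_class_in_center_iff)
    next
      show "scalar c \<in> {x. U_class q x \<in> ?S}" for c
        unfolding generated_subalgebra_def mem_Collect_eq
        by (intro generate_ring.incl UnI1 rangeI)
    qed (simp_all add: generated_subalgebra_def U_class_add U_class_mult
        generate_ring.incl generate_ring.eng_add generate_ring.eng_mult)
    then show "u \<in> ?S" by (simp add: z)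
  qed
  show "?S \<subseteq> ring_center (U_gh q)"
  proof
    fix u assume "u \<in> ?S"
    then have "\<exists>x. u = U_class q x \<and> central x"
      unfolding generated_subalgebra_def
    proof (induction rule: generate_ring.induct)
      case one
      then show ?case using central_scalar[of 1] U_class_one by auto
    next
      case (incl h)
      then show ?case
        using central_scalar central_G central_Gi central_H central_Hi central_casimir by auto
    next
      case (a_inv h)
      then obtain x where x: "h = U_class q x" "central x" by blast
      have "U_class q 0 = \<zero>\<^bsub>U_gh q\<^esub>"
        using U_class_add[of 0 0] by (simp add: carrier_U_gh)
      then have "U_class q (- x) \<oplus>\<^bsub>U_gh q\<^esub> U_class q x = \<zero>\<^bsub>U_gh q\<^esub>"
        by (simp flip: U_class_add)
      then have "\<ominus>\<^bsub>U_gh q\<^esub> h = U_class q (- x)"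
        unfolding x(1) by (intro U.minus_equality) (simp_all add: carrier_U_gh)
      then show ?case using central_uminus[OF x(2)] by blast
    next
      case (eng_add h1 h2)
      then show ?case using central_add U_class_add by metis
    next
      case (eng_mult h1 h2)
      then show ?case using central_mult U_class_mult by metis
    qed
    then show "u \<in> ring_center (U_gh q)" using U_class_in_center_iff by blast
  qed
qed

end

theorem corollary2p4:
  fixes q :: "'k::{alg_closed_field, field_char_0}"
  assumes "q \<noteq> 0" and "q ^ 2 \<noteq> 1"
    and not_root_of_unity: "\<forall>n::nat. n > 0 \<longrightarrow> q ^ n \<noteq> 1"
  shows "ring_center (U_gh q) =
    generated_subalgebra (\<lambda>c. U_class q (scalar c)) (U_gh q)
      {U_class q (free_gen gen_g), U_class q (free_gen gen_gi),
       U_class q (free_gen gen_h), U_class q (free_gen gen_hi),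
       U_class q (casimir q)}"
proof -
  interpret nonroot_of_unity q
    using assms by unfold_locales blast+
  show ?thesis by (rule center_U_gh)
qed

end
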